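(* Let $n\ge 2$, let $w$ be a non-empty braid word in $B_n$ in normal form, and let $k=\deg(w)\geq 1$. If the algorithm IsHalfTwist, run on the input $(w,k)$, returns true, then $w$ is a half-twist to the $k$-th power in $B_n$, i.e. the element of $B_n$ represented by $w$ equals $\beta^k$ for some half-twist $\beta\in B_n$ (equivalently, it is conjugate in $B_n$ to $\sigma_1^k$).
   Context: $B_n$ is Artin's braid group, generated by $\sigma_1,\dots,\sigma_{n-1}$ with relations $\sigma_i\sigma_j=\sigma_j\sigma_i$ for $|i-j|\ge 2$ and $\sigma_i\sigma_{i+1}\sigma_i=\sigma_{i+1}\sigma_i\sigma_{i+1}$ for $1\le i\le n-2$. A half-twist is an element of the conjugacy class of $\sigma_1$ in $B_n$ (all $\sigma_i$ are half-twists). A braid word is a finite sequence $\sigma_{i_1}^{e_1}\cdots\sigma_{i_l}^{e_l}$ with $e_j\in\{1,-1\}$; its length is $l$ and its degree is $\deg(w)=e_1+\dots+e_l$. Letters are numbered $1,\dots,l$; $w_{i,j}$ denotes the part of $w$ from the $i$-th to the $j$-th letter, and it is the empty word if $j<i$. A positive braid word is one with all $e_j=1$. A braid word is in normal form if it is $\Delta_n^{-r}w'$, where $\Delta_n=(\sigma_1\cdots\sigma_{n-1})(\sigma_1\cdots\sigma_{n-2})\cdots(\sigma_1\sigma_2)\sigma_1$, $r\ge 0$ is minimal and $w'$ is a positive braid word which is lexicographically smallest among the positive words representing the same element (so the word consists of negative letters followed by positive letters). Subroutines. For positive braid words $u,v$: WordExtractLeft$(u,v)$ returns false if there is no positive word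 $v''$ such that $u$ and $vv''$ represent the same element; otherwise it rewrites $u$, by the braid relations, as a positive word $vv''$ of the same length representing the same element. WordExtractRight$(u,v)$ is the same with $v''v$ in place of $vv''$. Extracting the empty word always succeeds. Algorithm IsHalfTwist$(w,k)$. Let $iPos$ be the position of the first positive letter of $w$ and $l$ the length of $w$. For $i=1,\dots,n-1$, for $t=0,\dots,k$, for $p=iPos-1,\dots,l$ do the following. (1) Apply WordExtractRight$(w_{iPos,p},\sigma_i^t)$; if it returns false, continue with the next $p$; otherwise replace $w_{iPos,p}$ inside $w$ by the rewritten word ending in $\sigma_i^t$. (2) Apply WordExtractLeft$(w_{p+1,l},\sigma_i^{k-t})$; if it returns false, continue with the next $p$; otherwise replace $w_{p+1,l}$ inside $w$ by the rewritten word beginning with $\sigma_i^{k-t}$. (3) Put $Test=w_{1,p-t}\,w_{p+k-t+1,l}$ and $q=(w_{p+k-t+1,l})^{-1}$. If $Test$ represents the identity of $B_n$, return true together with $q$ and $\sigma_i$. If the loops end without returning, return false. *)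

theory Defs
  imports "HOL-Algebra.Group"
begin

text \<open>A letter \<open>(i, e)\<close> with \<open>e \<in> {1, -1}\<close> stands for the \<open>e\<close>-th power of the \<open>i\<close>-th standard generator.\<close>

type_synonym letter = "nat \<times> int"
type_synonym braid_word = "letter list"

definition sigma :: "nat \<Rightarrow> letter" where
  "sigma i = (i, 1)"

definition braid_words :: "nat \<Rightarrow> braid_word set" where
  "braid_words n = lists ({1..<n} \<times> {1, -1})"

definition positive_words :: "nat \<Rightarrow> braid_word set" where
  "positive_words n = {w \<in> braid_words n. \<forall>x \<in> set w. snd x = 1}"

definition degree :: "braid_word \<Rightarrow> int" where
  "degree w = (\<Sum>x\<leftarrow>w. snd x)"

definition inverse_word :: "braid_word \<Rightarrow> braid_word" where
  "inverse_word w = map (\<lambda>(i, e). (i, -e)) (rev w)"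

text \<open>Letters are numbered from 1.\<close>

definition subword :: "braid_word \<Rightarrow> nat \<Rightarrow> nat \<Rightarrow> braid_word" where
  "subword w i j = take (Suc j - i) (drop (i - 1) w)"

definition replace_subword :: "braid_word \<Rightarrow> nat \<Rightarrow> nat \<Rightarrow> braid_word \<Rightarrow> braid_word" where
  "replace_subword w i j u = take (i - 1) w @ u @ drop j w"

text \<open>The congruence on words generated by free cancellation and the Artin relations.\<close>

inductive braid_equiv :: "nat \<Rightarrow> braid_word \<Rightarrow> braid_word \<Rightarrow> bool" for n where
  refl: "w \<in> braid_words n \<Longrightarrow> braid_equiv n w w"
| sym: "braid_equiv n u v \<Longrightarrow> braid_equiv n v u"
| trans: "braid_equiv n u v \<Longrightarrow> braid_equiv n v w \<Longrightarrow> braid_equiv n u w"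
| append: "braid_equiv n u u' \<Longrightarrow> braid_equiv n v v' \<Longrightarrow> braid_equiv n (u @ v) (u' @ v')"
| cancel: "i \<in> {1..<n} \<Longrightarrow> e \<in> {1, -1} \<Longrightarrow> braid_equiv n [(i, e), (i, -e)] []"
| far: "i \<in> {1..<n} \<Longrightarrow> j \<in> {1..<n} \<Longrightarrow> \<bar>int i - int j\<bar> \<ge> 2 \<Longrightarrow>
    braid_equiv n [sigma i, sigma j] [sigma j, sigma i]"
| braid: "1 \<le> i \<Longrightarrow> i + 2 \<le> n \<Longrightarrow>
    braid_equiv n [sigma i, sigma (i + 1), sigma i] [sigma (i + 1), sigma i, sigma (i + 1)]"

text \<open>Elements of the braid group are the congruence classes of words.\<close>

definition braid_of :: "nat \<Rightarrow> braid_word \<Rightarrow> braid_word set" where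
  "braid_of n w = {u. braid_equiv n w u}"

definition braid_group :: "nat \<Rightarrow> braid_word set monoid" where
  "braid_group n =
    \<lparr>carrier = braid_of n ` braid_words n,
     mult = (\<lambda>X Y. {w. \<exists>x \<in> X. \<exists>y \<in> Y. braid_equiv n (x @ y) w}),
     one = braid_of n []\<rparr>"

lemma braid_words_append_iff [simp]:
  "u @ v \<in> braid_words n \<longleftrightarrow> u \<in> braid_words n \<and> v \<in> braid_words n"
  by (auto simp: braid_words_def)

lemma Nil_in_braid_words [simp]: "[] \<in> braid_words n"
  by (simp add: braid_words_def)

lemma inverse_word_in_braid_words: "w \<in> braid_words n \<Longrightarrow> inverse_word w \<in> braid_words n"
  by (fastforce simp: braid_words_def inverse_word_def)

lemma braid_equiv_in_braid_words:
  "braid_equiv n u v \<Longrightarrow> u \<in> braid_words n \<and> v \<in> braid_words n"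
  by (induction rule: braid_equiv.induct) (auto simp: braid_words_def sigma_def)

lemma braid_equiv_degree: "braid_equiv n u v \<Longrightarrow> degree u = degree v"
  by (induction rule: braid_equiv.induct) (auto simp: degree_def sigma_def)

lemma braid_of_eq_iff:
  assumes "u \<in> braid_words n"
  shows "braid_of n u = braid_of n v \<longleftrightarrow> braid_equiv n u v"
  using assms unfolding braid_of_def
  by (blast intro: braid_equiv.refl braid_equiv.sym braid_equiv.trans)

lemma mult_braid_of:
  assumes "u \<in> braid_words n" "v \<in> braid_words n"
  shows "braid_of n u \<otimes>\<^bsub>braid_group n\<^esub> braid_of n v = braid_of n (u @ v)"
  using assms unfolding braid_of_def braid_group_def
  by (auto intro: braid_equiv.refl braid_equiv.append braid_equiv.trans)

lemma one_braid_group: "\<one>\<^bsub>braid_group n\<^esub> = braid_of n []"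
  by (simp add: braid_group_def)

lemma carrier_braid_group: "carrier (braid_group n) = braid_of n ` braid_words n"
  by (simp add: braid_group_def)

lemma inverse_word_left:
  "w \<in> braid_words n \<Longrightarrow> braid_equiv n (inverse_word w @ w) []"
proof (induction w)
  case Nil
  then show ?case by (simp add: inverse_word_def braid_equiv.refl)
next
  case (Cons x w)
  obtain i e where x: "x = (i, e)" by fastforce
  have w: "w \<in> braid_words n" and i: "i \<in> {1..<n}" "-e \<in> {1, -1}"
    using Cons.prems by (auto simp: braid_words_def x)
  have c: "braid_equiv n [(i, -e), (i, e)] []"
    using braid_equiv.cancel[OF i] by simp
  have "braid_equiv n (inverse_word w @ [(i, -e), (i, e)] @ w) (inverse_word w @ [] @ w)"
    by (intro braid_equiv.append c braid_equiv.refl w inverse_word_in_braid_words)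
  moreover have "inverse_word (x # w) @ x # w = inverse_word w @ [(i, -e), (i, e)] @ w"
    by (simp add: inverse_word_def x)
  ultimately show ?case
    using Cons.IH[OF w] by (metis append_Nil braid_equiv.trans)
qed

lemma group_braid_group: "group (braid_group n)"
proof (rule groupI)
  fix X assume "X \<in> carrier (braid_group n)"
  then obtain w where w: "w \<in> braid_words n" "X = braid_of n w"
    by (auto simp: carrier_braid_group)
  have "braid_of n (inverse_word w) \<otimes>\<^bsub>braid_group n\<^esub> X = \<one>\<^bsub>braid_group n\<^esub>"
    using w inverse_word_in_braid_words[OF w(1)] inverse_word_left[OF w(1)]
    by (simp add: mult_braid_of one_braid_group braid_of_eq_iff)
  then show "\<exists>Y \<in> carrier (braid_group n). Y \<otimes>\<^bsub>braid_group n\<^esub> X = \<one>\<^bsub>braid_group n\<^esub>"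
    using inverse_word_in_braid_words[OF w(1)] by (auto simp: carrier_braid_group)
qed (auto simp: carrier_braid_group mult_braid_of one_braid_group)

definition half_twists :: "nat \<Rightarrow> braid_word set set" where
  "half_twists n =
    {g \<otimes>\<^bsub>braid_group n\<^esub> braid_of n [sigma 1] \<otimes>\<^bsub>braid_group n\<^esub> inv\<^bsub>braid_group n\<^esub> g |
      g. g \<in> carrier (braid_group n)}"

definition Delta :: "nat \<Rightarrow> braid_word" where
  "Delta n = concat (map (\<lambda>m. map sigma [1..<Suc m]) (rev [1..<n]))"

definition Delta_neg_pow :: "nat \<Rightarrow> nat \<Rightarrow> braid_word" where
  "Delta_neg_pow n r = concat (replicate r (inverse_word (Delta n)))"

definition normal_form :: "nat \<Rightarrow> braid_word \<Rightarrow> bool" where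
  "normal_form n w \<longleftrightarrow>
    (\<exists>r. \<exists>w' \<in> positive_words n.
      w = Delta_neg_pow n r @ w' \<and>
      (\<forall>s. \<forall>u \<in> positive_words n. braid_of n w = braid_of n (Delta_neg_pow n s @ u) \<longrightarrow> r \<le> s) \<and>
      (\<forall>u \<in> positive_words n. braid_of n u = braid_of n w' \<longrightarrow>
        u = w' \<or> (map fst w', map fst u) \<in> lexord less_than))"

text \<open>The subroutines are only specified, not fixed: the positive word \<open>v''\<close> they find is not
  unique as a word. The result \<open>None\<close> means \<open>false\<close>; nothing is required on arguments
  that are not positive.\<close>

type_synonym extractor = "braid_word \<Rightarrow> braid_word \<Rightarrow> braid_word option"

definition word_extract_left :: "nat \<Rightarrow> extractor \<Rightarrow> bool" where
  "word_extract_left n ex \<longleftrightarrow>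
    (\<forall>u \<in> positive_words n. \<forall>v \<in> positive_words n.
      case ex u v of
        None \<Rightarrow> \<not> (\<exists>v'' \<in> positive_words n. braid_of n u = braid_of n (v @ v''))
      | Some u' \<Rightarrow> length u' = length u \<and> braid_of n u = braid_of n u' \<and>
          (\<exists>v'' \<in> positive_words n. u' = v @ v''))"

definition word_extract_right :: "nat \<Rightarrow> extractor \<Rightarrow> bool" where
  "word_extract_right n ex \<longleftrightarrow>
    (\<forall>u \<in> positive_words n. \<forall>v \<in> positive_words n.
      case ex u v of
        None \<Rightarrow> \<not> (\<exists>v'' \<in> positive_words n. braid_of n u = braid_of n (v'' @ v))
      | Some u' \<Rightarrow> length u' = length u \<and> braid_of n u = braid_of n u' \<and>
          (\<exists>v'' \<in> positive_words n. u' = v'' @ v))"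

text \<open>The last list holds the values of \<open>(i, t, p)\<close> still to be tried. The word \<open>w\<close> is
  the current one: its rewritings persist in later iterations, also when step (2) or (3) fails.\<close>

fun half_twist_loop ::
  "nat \<Rightarrow> extractor \<Rightarrow> extractor \<Rightarrow> nat \<Rightarrow> nat \<Rightarrow> nat \<Rightarrow> braid_word \<Rightarrow>
    (nat \<times> nat \<times> nat) list \<Rightarrow> (braid_word \<times> letter) option" where
  "half_twist_loop n exL exR k iPos l w [] = None"
| "half_twist_loop n exL exR k iPos l w ((i, t, p) # rest) =
    (case exR (subword w iPos p) (replicate t (sigma i)) of
      None \<Rightarrow> half_twist_loop n exL exR k iPos l w rest
    | Some u \<Rightarrow>
       (let w1 = replace_subword w iPos p u in
        case exL (subword w1 (p + 1) l) (replicate (k - t) (sigma i)) of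
          None \<Rightarrow> half_twist_loop n exL exR k iPos l w1 rest
        | Some v \<Rightarrow>
           (let w2 = replace_subword w1 (p + 1) l v;
                test = subword w2 1 (p - t) @ subword w2 (p + k - t + 1) l;
                q = inverse_word (subword w2 (p + k - t + 1) l)
            in if braid_of n test = \<one>\<^bsub>braid_group n\<^esub> then Some (q, sigma i)
               else half_twist_loop n exL exR k iPos l w2 rest)))"

definition first_positive :: "braid_word \<Rightarrow> nat" where
  "first_positive w = Suc (length (takeWhile (\<lambda>x. snd x \<noteq> 1) w))"

definition is_half_twist ::
  "nat \<Rightarrow> extractor \<Rightarrow> extractor \<Rightarrow> braid_word \<Rightarrow> nat \<Rightarrow> (braid_word \<times> letter) option" where
  "is_half_twist n exL exR w k =
    (let iPos = first_positive w; l = length w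
     in half_twist_loop n exL exR k iPos l w
          [(i, t, p). i \<leftarrow> [1..<n], t \<leftarrow> [0..<Suc k], p \<leftarrow> [iPos - 1..<Suc l]])"

end

theory Submission
  imports Defs
begin

text \<open>Every rewriting performed by the algorithm preserves the represented braid and the splitting
  of the word into its negative prefix \<open>N\<close> and a positive rest. On success the current word is
  \<open>N @ u @ \<sigma>\<^sub>i\<^sup>k @ v\<close> while \<open>N @ u @ v\<close> is trivial, so it represents the conjugate
  \<open>v\<^sup>-\<^sup>1 \<sigma>\<^sub>i\<^sup>k v\<close>; and each \<open>\<sigma>\<^sub>i\<close> is a half-twist, since \<open>\<sigma>\<^sub>i\<^sub>+\<^sub>1\<close> is the conjugate of \<open>\<sigma>\<^sub>i\<close>
  by \<open>\<sigma>\<^sub>i \<sigma>\<^sub>i\<^sub>+\<^sub>1\<close>.\<close>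

section \<open>Words: factors cut out by positions, inverses, positivity\<close>

lemma subword_append:
  assumes "i = Suc (length a)" "j = length a + length b"
  shows "subword (a @ b @ c) i j = b"
  using assms by (simp add: subword_def)

lemma replace_subword_append:
  assumes "i = Suc (length a)" "j = length a + length b"
  shows "replace_subword (a @ b @ c) i j u = a @ u @ c"
  using assms by (simp add: replace_subword_def)

lemma inverse_word_inverse_word [simp]: "inverse_word (inverse_word w) = w"
  by (simp add: inverse_word_def rev_map comp_def case_prod_beta)

lemma inverse_word_right:
  "w \<in> braid_words n \<Longrightarrow> braid_equiv n (w @ inverse_word w) []"
  using inverse_word_left[OF inverse_word_in_braid_words] by simp

lemma positive_words_append_iff [simp]:
  "u @ v \<in> positive_words n \<longleftrightarrow> u \<in> positive_words n \<and> v \<in> positive_words n"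
  by (auto simp: positive_words_def)

lemma positive_word_in_braid_words: "w \<in> positive_words n \<Longrightarrow> w \<in> braid_words n"
  by (simp add: positive_words_def)

lemma replicate_sigma_positive:
  "i \<in> {1..<n} \<Longrightarrow> replicate t (sigma i) \<in> positive_words n"
  by (auto simp: positive_words_def braid_words_def sigma_def)

section \<open>Extraction and the loop of the algorithm\<close>

lemma word_extract_rightD:
  assumes "word_extract_right n ex" "u \<in> positive_words n" "v \<in> positive_words n"
    and "ex u v = Some u'"
  obtains v'' where "v'' \<in> positive_words n" "u' = v'' @ v" "length u' = length u"
    "braid_equiv n u u'"
proof -
  have "length u' = length u \<and> braid_of n u = braid_of n u' \<and> (\<exists>v'' \<in> positive_words n. u' = v'' @ v)"
    using assms unfolding word_extract_right_def by fastforce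
  then show thesis
    using that braid_of_eq_iff[OF positive_word_in_braid_words[OF assms(2)]] by blast
qed

lemma word_extract_leftD:
  assumes "word_extract_left n ex" "u \<in> positive_words n" "v \<in> positive_words n"
    and "ex u v = Some u'"
  obtains v'' where "v'' \<in> positive_words n" "u' = v @ v''" "length u' = length u"
    "braid_equiv n u u'"
proof -
  have "length u' = length u \<and> braid_of n u = braid_of n u' \<and> (\<exists>v'' \<in> positive_words n. u' = v @ v'')"
    using assms unfolding word_extract_left_def by fastforce
  then show thesis
    using that braid_of_eq_iff[OF positive_word_in_braid_words[OF assms(2)]] by blast
qed

text \<open>If \<open>u @ v\<close> is trivial, \<open>u\<close> represents the inverse of
  \<open>v\<close>, so exchanging the prefix \<open>u\<close> exhibits a conjugate of
  \<open>s\<close>. In the loop, \<open>u @ v\<close> is the tested word and \<open>s\<close> the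
  block cut out of it.\<close>

lemma braid_equiv_conjugate:
  assumes "u @ s @ v \<in> braid_words n" and "braid_equiv n (u @ v) []"
  shows "braid_equiv n (u @ s @ v) (inverse_word v @ s @ v)"
proof -
  have w: "u \<in> braid_words n" "s \<in> braid_words n" "v \<in> braid_words n"
    "inverse_word v \<in> braid_words n"
    using assms(1) by (auto intro: inverse_word_in_braid_words)
  \<comment> \<open>The same word is reduced in two ways: to \<open>u\<close> by cancelling its end,
    and to \<open>inverse_word v\<close> by the hypothesis on \<open>u @ v\<close>.\<close>
  have "braid_equiv n (u @ v @ inverse_word v) (u @ [])"
    by (intro braid_equiv.append braid_equiv.refl inverse_word_right w)
  moreover have "braid_equiv n ((u @ v) @ inverse_word v) ([] @ inverse_word v)"
    by (intro braid_equiv.append braid_equiv.refl assms(2) w)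
  ultimately have "braid_equiv n u (inverse_word v)"
    by (auto intro: braid_equiv.sym braid_equiv.trans)
  then show ?thesis
    using w by (intro braid_equiv.append braid_equiv.refl)
qed

text \<open>Induction on the triples still to be tried. \<open>P\<close> varies because rewritings
  persist when a triple fails. \<open>N\<close> and \<open>l\<close> stay fixed because a rewriting
  keeps the length and affects only the positive part, so all positions keep their meaning.\<close>

lemma half_twist_loop_conjugate:
  assumes exL: "word_extract_left n exL" and exR: "word_extract_right n exR"
    and N: "N \<in> braid_words n"
  shows "half_twist_loop n exL exR k (Suc (length N)) l (N @ P) xs = Some (q, x) \<Longrightarrow>
    P \<in> positive_words n \<Longrightarrow> length (N @ P) = l \<Longrightarrow>
    \<forall>(i, t, p) \<in> set xs. i \<in> {1..<n} \<and> t \<le> k \<and> length N \<le> p \<and> p \<le> l \<Longrightarrow>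
    \<exists>i \<in> {1..<n}. q \<in> braid_words n \<and>
      braid_equiv n (N @ P) (q @ replicate k (sigma i) @ inverse_word q)"
proof (induction xs arbitrary: P)
  case Nil
  then show ?case by simp
next
  case (Cons a xs)
  obtain i t p where a: "a = (i, t, p)" by (cases a)
  \<comment> \<open>The positive part is cut behind letter \<open>p\<close> of the whole word; for
    \<open>p = length N\<close> the piece \<open>A\<close> is empty.\<close>
  define A B where "A = take (p - length N) P" and "B = drop (p - length N) P"
  have i: "i \<in> {1..<n}" and t: "t \<le> k" and p: "length N \<le> p" "p \<le> l"
    and rest: "\<forall>(i, t, p) \<in> set xs. i \<in> {1..<n} \<and> t \<le> k \<and> length N \<le> p \<and> p \<le> l"
    using Cons.prems(4) by (auto simp: a)
  have P: "P = A @ B" by (simp add: A_def B_def)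
  have A: "A \<in> positive_words n" and B: "B \<in> positive_words n"
    using Cons.prems(2) by (auto simp: P)
  have lA: "p = length N + length A" and lB: "l = p + length B"
    using Cons.prems(3) p by (auto simp: A_def B_def)
  have lP: "length P = length A + length B" by (simp add: P)
  \<comment> \<open>Shared by the three ways in which a triple can fail: the loop goes on with
    \<open>P'\<close> being \<open>P\<close>, \<open>u @ B\<close> or \<open>u @ v\<close>.\<close>
  have IH: ?case
    if "half_twist_loop n exL exR k (Suc (length N)) l (N @ P') xs = Some (q, x)"
      "P' \<in> positive_words n" "length P' = length P" "braid_equiv n P P'" for P'
  proof -
    have "braid_equiv n (N @ P) (N @ P')"
      using N that(4) by (intro braid_equiv.append braid_equiv.refl)
    then show ?thesis
      using Cons.IH[OF that(1,2) _ rest] that(3) Cons.prems(3) braid_equiv.trans by fastforce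
  qed
  have s1: "subword (N @ P) (Suc (length N)) p = A"
    unfolding P by (rule subword_append) (simp_all add: lA)
  show ?case
  proof (cases "exR A (replicate t (sigma i))")
    case None
    then show ?thesis
      using IH[of P] Cons.prems(1,2)
      by (simp add: a s1 braid_equiv.refl positive_word_in_braid_words)
  next
    case (Some u)
    obtain u'' where u'': "u'' \<in> positive_words n" and u: "u = u'' @ replicate t (sigma i)"
      and lu: "length u = length A" and eu: "braid_equiv n A u"
      using word_extract_rightD[OF exR A replicate_sigma_positive[OF i] Some] .
    have up: "u \<in> positive_words n"
      using u'' i by (simp add: u replicate_sigma_positive)
    have s2: "replace_subword (N @ P) (Suc (length N)) p u = N @ u @ B"
      unfolding P by (rule replace_subword_append) (simp_all add: lA)
    \<comment> \<open>As \<open>u\<close> is as long as \<open>A\<close>, the second piece still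
      starts right after position \<open>p\<close>. It reaches the end of the word, hence the empty
      third factor.\<close>
    have s3: "subword (N @ u @ B) (Suc p) l = B"
      using subword_append[of "Suc p" "N @ u" l B "[]"] by (simp add: lA lB lu)
    show ?thesis
    proof (cases "exL B (replicate (k - t) (sigma i))")
      case None
      have "braid_equiv n P (u @ B)"
        unfolding P using eu B
        by (intro braid_equiv.append braid_equiv.refl positive_word_in_braid_words)
      with None Some show ?thesis
        using IH[of "u @ B"] Cons.prems(1) up B lu by (simp add: a s1 s2 s3 lP)
    next
      case SomeL: (Some v)
      obtain v'' where v'': "v'' \<in> positive_words n"
        and v: "v = replicate (k - t) (sigma i) @ v''"
        and lv: "length v = length B" and ev: "braid_equiv n B v"
        using word_extract_leftD[OF exL B replicate_sigma_positive[OF i] SomeL] .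
      have vp: "v \<in> positive_words n"
        using v'' i by (simp add: v replicate_sigma_positive)
      have euv: "braid_equiv n P (u @ v)"
        unfolding P using eu ev by (rule braid_equiv.append)
      have s4: "replace_subword (N @ u @ B) (Suc p) l v = N @ u @ v"
        using replace_subword_append[of "Suc p" "N @ u" l B "[]"] by (simp add: lA lB lu)
      \<comment> \<open>The powers \<open>t\<close> and \<open>k - t\<close> of
        \<open>sigma i\<close> meet at position \<open>p\<close> and merge into the full
        \<open>k\<close>-th power, as \<open>t \<le> k\<close>.\<close>
      have w2: "N @ u @ v = (N @ u'') @ replicate k (sigma i) @ v''"
        using t replicate_add[of t "k - t" "sigma i"] by (simp add: u v)
      \<comment> \<open>The two ends of the block. The subtractions on \<open>nat\<close> are exact:
        \<open>u\<close> ends in \<open>t\<close> letters, so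
        \<open>t \<le> length A \<le> p\<close>.\<close>
      have pt: "p - t = length (N @ u'')" "p + k - t = length (N @ u'' @ replicate k (sigma i))"
        using lu t by (simp_all add: lA u)
      have l: "l = length (N @ u'' @ replicate k (sigma i) @ v'')"
        using arg_cong[OF w2, of length] by (simp add: lA lB lu lv)
      have s5: "subword (N @ u @ v) (Suc 0) (p - t) = N @ u''"
        unfolding w2 pt using subword_append[of "Suc 0" "[]" _ "N @ u''"] by simp
      have s6: "subword (N @ u @ v) (Suc (p + k - t)) l = v''"
        unfolding w2 pt l
        using subword_append[of _ "N @ u'' @ replicate k (sigma i)" _ v'' "[]"] by (simp add: add.assoc)
      show ?thesis
      \<comment> \<open>The tested word is the current word with the block of \<open>k\<close>
        letters deleted.\<close>
      proof (cases "braid_of n (N @ u'' @ v'') = \<one>\<^bsub>braid_group n\<^esub>")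
        case True
        have q: "q = inverse_word v''"
          using Cons.prems(1) True by (simp add: a s1 s2 s3 s4 s5 s6 Some SomeL Let_def)
        have W: "N @ u'' @ v'' \<in> braid_words n" "(N @ u'') @ replicate k (sigma i) @ v'' \<in> braid_words n"
          using N u'' v'' replicate_sigma_positive[OF i] by (simp_all add: positive_word_in_braid_words)
        have "braid_equiv n ((N @ u'') @ v'') []"
          using True braid_of_eq_iff[OF W(1)] by (simp add: one_braid_group)
        note braid_equiv_conjugate[OF W(2) this]
        moreover have "braid_equiv n (N @ P) (N @ u @ v)"
          using N euv by (intro braid_equiv.append braid_equiv.refl)
        \<comment> \<open>\<open>inverse_word q\<close> is \<open>v''\<close> again, so the
          conjugator is exactly the returned word.\<close>
        ultimately have "braid_equiv n (N @ P) (q @ replicate k (sigma i) @ inverse_word q)"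
          unfolding q w2 by (simp add: braid_equiv.trans)
        then show ?thesis
          using i v'' by (auto simp: q intro: inverse_word_in_braid_words positive_word_in_braid_words)
      next
        case False
        then show ?thesis
          using IH[of "u @ v"] Cons.prems(1) up vp lu lv euv
          by (simp add: a s1 s2 s3 s4 s5 s6 Some SomeL Let_def lP)
      qed
    qed
  qed
qed

section \<open>Conjugates and powers; the generators as half-twists\<close>

lemma (in group) pow_conjugate:
  assumes "g \<in> carrier G" "h \<in> carrier G"
  shows "(g \<otimes> h \<otimes> inv g) [^] (k::nat) = g \<otimes> h [^] k \<otimes> inv g"
proof (induction k)
  case 0
  then show ?case using assms by simp
next
  case (Suc k)
  \<comment> \<open>The inner pair of \<open>(g h^k g^-1) (g h g^-1)\<close> cancels; the bracketing
    is the one that \<open>m_assoc\<close> produces.\<close>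
  have "inv g \<otimes> (g \<otimes> (h \<otimes> inv g)) = h \<otimes> inv g"
    using assms by (simp flip: m_assoc)
  then show ?case using Suc assms by (simp add: m_assoc)
qed

text \<open>Conjugating by \<open>g\<close> only changes the conjugator of \<open>sigma 1\<close>
  from \<open>h\<close> to the product \<open>g h\<close>.\<close>

lemma half_twists_conjugate:
  assumes "\<beta> \<in> half_twists n" "n \<ge> 2" "g \<in> carrier (braid_group n)"
  shows "g \<otimes>\<^bsub>braid_group n\<^esub> \<beta> \<otimes>\<^bsub>braid_group n\<^esub> inv\<^bsub>braid_group n\<^esub> g \<in> half_twists n"
proof -
  interpret group "braid_group n" by (rule group_braid_group)
  obtain h where h: "h \<in> carrier (braid_group n)"
    "\<beta> = h \<otimes>\<^bsub>braid_group n\<^esub> braid_of n [sigma 1] \<otimes>\<^bsub>braid_group n\<^esub> inv\<^bsub>braid_group n\<^esub> h"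
    using assms(1) by (auto simp: half_twists_def)
  have s: "braid_of n [sigma 1] \<in> carrier (braid_group n)"
    using assms(2) by (auto simp: carrier_braid_group braid_words_def sigma_def)
  have "g \<otimes>\<^bsub>braid_group n\<^esub> \<beta> \<otimes>\<^bsub>braid_group n\<^esub> inv\<^bsub>braid_group n\<^esub> g =
    (g \<otimes>\<^bsub>braid_group n\<^esub> h) \<otimes>\<^bsub>braid_group n\<^esub> braid_of n [sigma 1]
      \<otimes>\<^bsub>braid_group n\<^esub> inv\<^bsub>braid_group n\<^esub> (g \<otimes>\<^bsub>braid_group n\<^esub> h)"
    using h s assms(3) by (simp add: m_assoc inv_mult_group)
  then show ?thesis
    using h(1) assms(3) unfolding half_twists_def by blast
qed

lemma sigma_in_half_twists:
  assumes "i \<ge> 1" "i < n"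
  shows "braid_of n [sigma i] \<in> half_twists n"
  using assms
proof (induction i rule: dec_induct)
  case base
  interpret group "braid_group n" by (rule group_braid_group)
  have "braid_of n [sigma 1] \<in> carrier (braid_group n)"
    using base by (auto simp: carrier_braid_group braid_words_def sigma_def)
  then have "braid_of n [sigma 1] = \<one>\<^bsub>braid_group n\<^esub> \<otimes>\<^bsub>braid_group n\<^esub> braid_of n [sigma 1]
      \<otimes>\<^bsub>braid_group n\<^esub> inv\<^bsub>braid_group n\<^esub> \<one>\<^bsub>braid_group n\<^esub>"
    by simp
  then show ?case unfolding half_twists_def by blast
next
  case (step i)
  interpret group "braid_group n" by (rule group_braid_group)
  define g where "g = braid_of n [sigma i, sigma (Suc i)]"
  have W: "[sigma i] \<in> braid_words n" "[sigma (Suc i)] \<in> braid_words n"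
    "[sigma i, sigma (Suc i)] \<in> braid_words n" "[sigma i, sigma (Suc i), sigma i] \<in> braid_words n"
    using step by (auto simp: braid_words_def sigma_def)
  then have c: "g \<in> carrier (braid_group n)" "braid_of n [sigma i] \<in> carrier (braid_group n)"
    "braid_of n [sigma (Suc i)] \<in> carrier (braid_group n)"
    by (auto simp: g_def carrier_braid_group)
  have "braid_of n [sigma i, sigma (Suc i), sigma i] =
      braid_of n [sigma (Suc i), sigma i, sigma (Suc i)]"
    using braid_equiv.braid[of i n] step W by (simp add: braid_of_eq_iff)
  \<comment> \<open>Splitting off the last letter on the left and the first letter on the right
    turns the braid relation into a commutation rule for \<open>g\<close>.\<close>
  then have "g \<otimes>\<^bsub>braid_group n\<^esub> braid_of n [sigma i] =
      braid_of n [sigma (Suc i)] \<otimes>\<^bsub>braid_group n\<^esub> g"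
    using W by (simp add: g_def mult_braid_of)
  then have "g \<otimes>\<^bsub>braid_group n\<^esub> braid_of n [sigma i] \<otimes>\<^bsub>braid_group n\<^esub>
      inv\<^bsub>braid_group n\<^esub> g = braid_of n [sigma (Suc i)]"
    using c by (simp add: m_assoc)
  then show ?case
    using half_twists_conjugate[OF step.IH _ c(1)] step by simp
qed

lemma braid_of_replicate:
  assumes "[s] \<in> braid_words n"
  shows "braid_of n (replicate k s) = braid_of n [s] [^]\<^bsub>braid_group n\<^esub> k"
proof -
  interpret group "braid_group n" by (rule group_braid_group)
  have "replicate k s \<in> braid_words n" for k
    using assms by (auto simp: braid_words_def)
  then show ?thesis
  proof (induction k)
    case 0
    then show ?case by (simp add: one_braid_group)
  next
    case (Suc k)
    then show ?case using assms mult_braid_of[of "replicate k s" n "[s]"]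
      by (simp add: replicate_append_same)
  qed
qed

lemma inv_braid_of:
  assumes "w \<in> braid_words n"
  shows "inv\<^bsub>braid_group n\<^esub> braid_of n w = braid_of n (inverse_word w)"
proof -
  interpret group "braid_group n" by (rule group_braid_group)
  show ?thesis
    using assms inverse_word_in_braid_words[OF assms] inverse_word_left[OF assms]
    by (intro inv_equality)
      (auto simp: mult_braid_of one_braid_group braid_of_eq_iff carrier_braid_group)
qed

section \<open>The positive part of a normal form, and the conclusion\<close>

lemma normal_form_dropWhile_positive:
  assumes "normal_form n w"
  shows "dropWhile (\<lambda>x. snd x \<noteq> 1) w \<in> positive_words n"
proof -
  obtain r w' where w': "w' \<in> positive_words n" and w: "w = Delta_neg_pow n r @ w'"
    using assms by (auto simp: normal_form_def)
  have "\<forall>x \<in> set (Delta_neg_pow n r). snd x \<noteq> 1"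
    by (auto simp: Delta_neg_pow_def inverse_word_def Delta_def sigma_def)
  then have "dropWhile (\<lambda>x. snd x \<noteq> 1) w = dropWhile (\<lambda>x. snd x \<noteq> 1) w'"
    by (simp add: w)
  \<comment> \<open>A non-empty \<open>w'\<close> starts with a positive letter, so nothing is
    dropped from it.\<close>
  also have "\<dots> = w'"
    using w' by (cases w') (auto simp: positive_words_def)
  finally show ?thesis using w' by simp
qed

theorem proposition3p3:
  fixes n k :: nat and w q :: braid_word and x :: letter and exL exR :: extractor
  assumes "n \<ge> 2"
    and "w \<in> braid_words n" and "w \<noteq> []" and "normal_form n w"
    and "int k = degree w" and "k \<ge> 1"
    and "word_extract_left n exL" and "word_extract_right n exR"
    and "is_half_twist n exL exR w k = Some (q, x)"
  shows "\<exists>\<beta> \<in> half_twists n. braid_of n w = \<beta> [^]\<^bsub>braid_group n\<^esub> k"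
proof -
  interpret group "braid_group n" by (rule group_braid_group)
  \<comment> \<open>The cut is made at the first positive letter, as in the algorithm;
    \<open>P\<close> is empty if there is none.\<close>
  define N P where "N = takeWhile (\<lambda>x. snd x \<noteq> 1) w" and "P = dropWhile (\<lambda>x. snd x \<noteq> 1) w"
  have w: "w = N @ P" by (simp add: N_def P_def)
  have P: "P \<in> positive_words n"
    unfolding P_def by (rule normal_form_dropWhile_positive) fact
  have N: "N \<in> braid_words n" using assms(2) by (simp add: w)
  have fp: "first_positive w = Suc (length N)" by (simp add: first_positive_def N_def)
  define xs where
    "xs = [(i, t, p). i \<leftarrow> [1..<n], t \<leftarrow> [0..<Suc k], p \<leftarrow> [length N..<Suc (length w)]]"
  have loop: "half_twist_loop n exL exR k (Suc (length N)) (length w) (N @ P) xs = Some (q, x)"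
    using assms(9) unfolding is_half_twist_def Let_def fp xs_def w[symmetric] by (simp del: upt_Suc)
  have "\<forall>(i, t, p) \<in> set xs. i \<in> {1..<n} \<and> t \<le> k \<and> length N \<le> p \<and> p \<le> length w"
    by (auto simp: xs_def simp del: upt_Suc)
  from half_twist_loop_conjugate[OF assms(7,8) N loop P _ this]
  obtain i where i: "i \<in> {1..<n}" and q: "q \<in> braid_words n"
    and eq: "braid_equiv n w (q @ replicate k (sigma i) @ inverse_word q)"
    by (auto simp: w)
  have s: "[sigma i] \<in> braid_words n" "replicate k (sigma i) \<in> braid_words n"
    using i by (auto simp: braid_words_def sigma_def)
  have c: "braid_of n q \<in> carrier (braid_group n)" "braid_of n [sigma i] \<in> carrier (braid_group n)"
    using q s by (auto simp: carrier_braid_group)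
  have "braid_of n w = braid_of n q \<otimes>\<^bsub>braid_group n\<^esub> braid_of n [sigma i] [^]\<^bsub>braid_group n\<^esub> k
      \<otimes>\<^bsub>braid_group n\<^esub> inv\<^bsub>braid_group n\<^esub> braid_of n q"
    using eq q s assms(2) inverse_word_in_braid_words[OF q]
    by (simp add: inv_braid_of mult_braid_of braid_of_eq_iff flip: braid_of_replicate)
  \<comment> \<open>The conjugate of a power is the power of the conjugate: the half-twist sought is
    \<open>sigma i\<close> conjugated by the returned word \<open>q\<close>.\<close>
  also have "\<dots> = (braid_of n q \<otimes>\<^bsub>braid_group n\<^esub> braid_of n [sigma i]
      \<otimes>\<^bsub>braid_group n\<^esub> inv\<^bsub>braid_group n\<^esub> braid_of n q) [^]\<^bsub>braid_group n\<^esub> k"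
    using c by (simp add: pow_conjugate)
  finally show ?thesis
    using half_twists_conjugate[OF sigma_in_half_twists assms(1) c(1)] i by auto
qed

end
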